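(* Let $q$ be a prime power and $n\ge 1$ an integer. Let $L_1,\dots,L_c$ be lines in $\mathbb{F}_q^n$ and $X=\bigcup_{i=1}^c L_i$. On each $L_i$, pick a subset $\gamma_i\subset L_i$ such that $|\gamma_i|\geq\frac q2$, and let $Y=\bigcup_{i=1}^c\gamma_i$. Then $$ |Y| \geq \frac{1}{n!\cdot 2^n}\,|X|. $$
   Context: $\mathbb{F}_q$ is the finite field with $q$ elements. A line is a one-dimensional affine subspace of $\mathbb{F}_q^n$. *)

theory Defs
  imports "HOL-Analysis.Analysis"
begin

text \<open>A line in \<open>F\<^sup>n\<close>: a translate of a linear subspace of dimension one over the scalar field
  \<open>'a\<close>. (The library's \<^const>\<open>affine\<close> is about real scalars only; \<open>vec\<close> is the
  interpretation of the vector space locale for \<open>'a ^ 'n\<close> with scalar multiplication \<open>*s\<close>.)\<close>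

definition affine_line :: "('a::field ^ 'n) set \<Rightarrow> bool" where
  "affine_line L \<longleftrightarrow> (\<exists>a W. vec.subspace W \<and> vec.dim W = 1 \<and> L = (\<lambda>w. a + w) ` W)"

end

theory Submission
  imports Defs "HOL-Computational_Algebra.Polynomial"
begin

text \<open>Let \<open>d\<close> be the largest integer below \<open>q / 2\<close>. A polynomial of degree at most \<open>d\<close> that vanishes
  on \<open>Y\<close> vanishes on every line, hence on \<open>X\<close>. Polynomials of degree at most \<open>d\<close> interpolate
  arbitrary values on each translate of the simplicial grid of points with coordinate indices of sum
  at most \<open>d\<close>, which has \<open>(n + d) choose d\<close> points. By averaging, some translate meets \<open>X\<close> in a set
  \<open>S\<close> with \<open>card S \<ge> ((n + d) choose d) / q ^ n * card X\<close>. An interpolant on \<open>S\<close> is determined on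
  \<open>S\<close> by its values on \<open>Y\<close>, so \<open>q ^ card S \<le> q ^ card Y\<close>.\<close>

section \<open>Functions of bounded degree on every line\<close>

text \<open>Only the restrictions to lines matter, so membership in the space of polynomials of degree at
  most \<open>d\<close> is expressed through them; this avoids multivariate polynomials.\<close>

definition poly_on_lines :: "nat \<Rightarrow> ('a::field ^ 'n \<Rightarrow> 'a) \<Rightarrow> bool" where
  "poly_on_lines d f \<longleftrightarrow> (\<forall>a v. \<exists>p. degree p \<le> d \<and> (\<forall>t. f (a + t *s v) = poly p t))"

lemma poly_on_lines_zero: "poly_on_lines d (\<lambda>x. 0)"
  unfolding poly_on_lines_def by (metis degree_0 le0 poly_0)

lemma poly_on_lines_add:
  assumes "poly_on_lines d f" "poly_on_lines d g"
  shows "poly_on_lines d (\<lambda>x. f x + g x)"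
  unfolding poly_on_lines_def
proof (intro allI)
  fix a v
  obtain p r where "degree p \<le> d" "\<forall>t. f (a + t *s v) = poly p t"
    and "degree r \<le> d" "\<forall>t. g (a + t *s v) = poly r t"
    using assms unfolding poly_on_lines_def by meson
  then show "\<exists>p. degree p \<le> d \<and> (\<forall>t. f (a + t *s v) + g (a + t *s v) = poly p t)"
    by (intro exI[of _ "p + r"]) (simp add: degree_add_le)
qed

lemma poly_on_lines_scale:
  assumes "poly_on_lines d f"
  shows "poly_on_lines d (\<lambda>x. c * f x)"
  unfolding poly_on_lines_def
proof (intro allI)
  fix a v
  obtain p where "degree p \<le> d" "\<forall>t. f (a + t *s v) = poly p t"
    using assms unfolding poly_on_lines_def by meson
  then show "\<exists>p. degree p \<le> d \<and> (\<forall>t. c * f (a + t *s v) = poly p t)"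
    by (intro exI[of _ "smult c p"]) (simp add: order_trans[OF degree_smult_le])
qed

lemma poly_on_lines_diff:
  assumes "poly_on_lines d f" "poly_on_lines d g"
  shows "poly_on_lines d (\<lambda>x. f x - g x)"
  using poly_on_lines_add[OF assms(1) poly_on_lines_scale[OF assms(2), of "-1"]] by simp

lemma affine_lineE:
  fixes L :: "('a::field ^ 'n) set"
  assumes "affine_line L"
  obtains a v where "L = range (\<lambda>t. a + t *s v)"
proof -
  obtain a W where W: "vec.subspace W" "vec.dim W = 1" "L = (\<lambda>w. a + w) ` W"
    using assms unfolding affine_line_def by blast
  obtain B where B: "B \<subseteq> W" "vec.independent B" "W \<subseteq> vec.span B" "card B = vec.dim W"
    using vec.basis_exists by blast
  obtain v where v: "B = {v}"
    using B(4) W(2) by (metis card_1_singletonE)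
  have "vec.span B = W"
    using B W(1) by (metis subset_antisym vec.span_minimal)
  then have "W = range (\<lambda>t. t *s v)"
    by (simp add: v vec.span_singleton)
  then show ?thesis
    using that[of a v] W(3) by (simp add: image_image)
qed

text \<open>The restriction of \<open>f\<close> to \<open>L\<close> is a polynomial of degree at
  most \<open>d\<close> in the line parameter. Every point of \<open>G\<close> comes from at least
  one parameter, so this polynomial has more than \<open>d\<close> roots and is zero.\<close>

lemma poly_on_lines_eq_zero_line:
  fixes L :: "('a::{field,finite} ^ 'n) set"
  assumes f: "poly_on_lines d f" and L: "affine_line L"
    and G: "G \<subseteq> L" "d < card G" and zero: "\<And>x. x \<in> G \<Longrightarrow> f x = 0"
    and x: "x \<in> L"
  shows "f x = 0"
proof -
  obtain a v where v: "L = range (\<lambda>t. a + t *s v)"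
    by (rule affine_lineE[OF L])
  obtain p where p: "degree p \<le> d" "\<And>t. f (a + t *s v) = poly p t"
    using f unfolding poly_on_lines_def by meson
  define T where "T = {t. a + t *s v \<in> G}"
  have "G = (\<lambda>t. a + t *s v) ` T"
    using G(1) v by (auto simp: T_def)
  then have "card G \<le> card T"
    by (simp add: card_image_le)
  also have "\<dots> \<le> card {t. poly p t = 0}"
    by (intro card_mono) (auto simp: T_def zero simp flip: p(2))
  finally have "d < card {t. poly p t = 0}"
    using G(2) by simp
  then have "p = 0"
    using card_poly_roots_bound[of p] p(1) by (meson le_trans not_le)
  then show ?thesis
    using x v p(2) by auto
qed

section \<open>Newton interpolation on a translated simplicial grid\<close>

text \<open>The Newton basis polynomial of index \<open>m\<close>: in coordinate \<open>j\<close>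
  its nodes are the first \<open>m j\<close> grid values, and its total degree is
  \<open>sum m UNIV\<close>.\<close>

definition grid_newton :: "(nat \<Rightarrow> 'a::field) \<Rightarrow> 'a ^ 'n \<Rightarrow> ('n \<Rightarrow> nat) \<Rightarrow> 'a ^ 'n \<Rightarrow> 'a" where
  "grid_newton e g m x = (\<Prod>j\<in>UNIV. \<Prod>k<m j. x $ j - g $ j - e k)"

lemma poly_on_lines_grid_newton:
  fixes e :: "nat \<Rightarrow> 'a::field" and g :: "'a ^ 'n"
  assumes "sum m UNIV \<le> d"
  shows "poly_on_lines d (grid_newton e g m)"
  unfolding poly_on_lines_def
proof (intro allI)
  fix a v :: "'a ^ 'n"
  define p where "p = (\<Prod>j\<in>UNIV. \<Prod>k<m j. [:a $ j - g $ j - e k, v $ j:])"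
  have "degree p \<le> (\<Sum>j\<in>UNIV. degree (\<Prod>k<m j. [:a $ j - g $ j - e k, v $ j:]))"
    unfolding p_def by (rule order_trans[OF degree_prod_sum_le]) (simp_all add: o_def)
  also have "\<dots> \<le> sum m UNIV"
  proof (rule sum_mono)
    fix j
    have "degree (\<Prod>k<m j. [:a $ j - g $ j - e k, v $ j:])
        \<le> (\<Sum>k<m j. degree [:a $ j - g $ j - e k, v $ j:])"
      by (rule order_trans[OF degree_prod_sum_le]) (simp_all add: o_def)
    also have "\<dots> \<le> (\<Sum>k<m j. 1)"
      by (intro sum_mono) simp
    finally show "degree (\<Prod>k<m j. [:a $ j - g $ j - e k, v $ j:]) \<le> m j"
      by simp
  qed
  finally have "degree p \<le> d"
    using assms by simp
  moreover have "grid_newton e g m (a + t *s v) = poly p t" for t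
    by (simp add: grid_newton_def p_def poly_prod algebra_simps)
  ultimately show "\<exists>p. degree p \<le> d \<and> (\<forall>t. grid_newton e g m (a + t *s v) = poly p t)"
    by blast
qed

text \<open>The factors of coordinate \<open>j\<close> vanish exactly at the nodes with index below
  \<open>m j\<close>. All indices involved are at most \<open>d\<close>, where \<open>e\<close> is
  injective, so equal nodes have equal indices.\<close>

lemma grid_newton_eq_0_iff:
  assumes e: "inj_on e {..d}" and m: "sum m UNIV \<le> d" and m': "sum m' UNIV \<le> d"
  shows "grid_newton e g m (g + (\<chi> j. e (m' j))) = 0 \<longleftrightarrow> (\<exists>j. m' j < m j)"
proof -
  have le: "m j \<le> d" "m' j \<le> d" for j
    using member_le_sum[of j UNIV m] member_le_sum[of j UNIV m'] m m' by auto
  have "e (m' j) = e k \<longleftrightarrow> m' j = k" if "k < m j" for j k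
    using e le[of j] that by (auto dest: inj_onD)
  then show ?thesis
    by (auto simp: grid_newton_def)
qed

text \<open>Newton interpolation, adding one point at a time. \<open>M\<close> may be any finite
  part of the grid, so that the induction can remove an index of maximal sum; the Newton polynomial
  of that index vanishes at all other points of \<open>M\<close> but not at its own.\<close>

lemma grid_interpolation:
  fixes e :: "nat \<Rightarrow> 'a::field" and g :: "'a ^ 'n" and \<phi> :: "('n \<Rightarrow> nat) \<Rightarrow> 'a"
  assumes e: "inj_on e {..d}" and "finite M" and "\<And>m. m \<in> M \<Longrightarrow> sum m UNIV \<le> d"
  shows "\<exists>f. poly_on_lines d f \<and> (\<forall>m\<in>M. f (g + (\<chi> j. e (m j))) = \<phi> m)"
  using assms(2,3)
proof (induction "card M" arbitrary: M)
  case 0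
  then show ?case
    using poly_on_lines_zero by auto
next
  case (Suc N)
  let ?pt = "\<lambda>m. g + (\<chi> j. e (m j))"
  have "M \<noteq> {}"
    using Suc by auto
  then obtain m where m: "m \<in> M" "\<And>m'. m' \<in> M \<Longrightarrow> sum m' UNIV \<le> sum m UNIV"
    using obtains_MAX[OF Suc.prems(1), of "\<lambda>m. sum m UNIV"] Suc.prems(1)
    by (metis Max_ge finite_imageI image_eqI)
  obtain f where f: "poly_on_lines d f" "\<forall>m\<in>M - {m}. f (?pt m) = \<phi> m"
    using Suc.hyps(1)[of "M - {m}"] Suc.hyps(2)[symmetric] Suc.prems m(1) by auto
  define h where "h = grid_newton e g m"
  have h: "poly_on_lines d h"
    unfolding h_def using Suc.prems(2)[OF m(1)] by (rule poly_on_lines_grid_newton)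
  have hm: "h (?pt m) \<noteq> 0"
    unfolding h_def using grid_newton_eq_0_iff[OF e] Suc.prems(2) m(1) by blast
  have h0: "h (?pt m') = 0" if m': "m' \<in> M" "m' \<noteq> m" for m'
  proof -
    \<comment> \<open>Otherwise \<open>m'\<close> dominates \<open>m\<close> in every coordinate and
      differs from it, so its sum is larger, against the maximality of \<open>m\<close>.\<close>
    have "\<exists>j. m' j < m j"
    proof (rule ccontr)
      assume "\<not> (\<exists>j. m' j < m j)"
      then have le: "m j \<le> m' j" for j
        using not_less by blast
      obtain j where "m j \<noteq> m' j"
        using m'(2) by (metis ext)
      then have "sum m UNIV < sum m' UNIV"
        using le by (intro sum_strict_mono_ex1) (auto simp: order_less_le)
      then show False
        using m(2)[OF m'(1)] by simp
    qed
    then show ?thesis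
      unfolding h_def using grid_newton_eq_0_iff[OF e] Suc.prems(2) m'(1) m(1) by blast
  qed
  \<comment> \<open>This coefficient corrects the value at the removed point; since \<open>h\<close>
    vanishes at the others, their values stay.\<close>
  define c where "c = (\<phi> m - f (?pt m)) / h (?pt m)"
  have "poly_on_lines d (\<lambda>x. f x + c * h x)"
    by (intro poly_on_lines_add poly_on_lines_scale f(1) h)
  moreover have "f (?pt m') + c * h (?pt m') = \<phi> m'" if "m' \<in> M" for m'
    using f(2) h0 hm that by (cases "m' = m") (auto simp: c_def)
  ultimately show ?case
    by blast
qed

section \<open>Size of the simplicial grid\<close>

text \<open>Splitting by the value \<open>k\<close> at the inserted element leaves functions on
  \<open>A\<close> of sum at most \<open>d - k\<close>. Being zero outside \<open>A\<close> makes a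
  function determined by its values on \<open>A\<close>. Finiteness is carried along because the
  cardinality of the disjoint union relies on it.\<close>

lemma card_functions_sum_le:
  fixes A :: "'b set"
  assumes "finite A"
  shows "finite {m :: 'b \<Rightarrow> nat. (\<forall>x. x \<notin> A \<longrightarrow> m x = 0) \<and> sum m A \<le> d} \<and>
    card {m :: 'b \<Rightarrow> nat. (\<forall>x. x \<notin> A \<longrightarrow> m x = 0) \<and> sum m A \<le> d} = (card A + d) choose d"
  using assms
proof (induction A arbitrary: d)
  case empty
  have "{m :: 'b \<Rightarrow> nat. (\<forall>x. x \<notin> {} \<longrightarrow> m x = 0) \<and> sum m {} \<le> d} = {\<lambda>x. 0}"
    by auto
  then show ?case
    by simp
next
  case (insert a A)
  let ?F = "\<lambda>A d. {m :: 'b \<Rightarrow> nat. (\<forall>x. x \<notin> A \<longrightarrow> m x = 0) \<and> sum m A \<le> d}"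
  have *: "(\<Sum>x\<in>A. if x = a then k else m x) = sum m A" for m :: "'b \<Rightarrow> nat" and k
    using insert.hyps by (intro sum.cong) auto
  have bij: "bij_betw (\<lambda>(k, m). m(a := k)) (SIGMA k:{..d}. ?F A (d - k)) (?F (insert a A) d)"
  proof (rule bij_betw_byWitness[where f' = "\<lambda>m. (m a, m(a := 0))"])
    show "\<forall>p\<in>SIGMA k:{..d}. ?F A (d - k).
        (\<lambda>m. (m a, m(a := 0))) ((\<lambda>(k, m). m(a := k)) p) = p"
      using insert.hyps(2) by (auto simp: fun_upd_idem)
    show "(\<lambda>(k, m). m(a := k)) ` (SIGMA k:{..d}. ?F A (d - k)) \<subseteq> ?F (insert a A) d"
      using insert.hyps by (auto simp: *)
    show "(\<lambda>m. (m a, m(a := 0))) ` ?F (insert a A) d \<subseteq> (SIGMA k:{..d}. ?F A (d - k))"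
      using insert.hyps by (auto simp: *)
  qed simp
  have fin: "finite (SIGMA k:{..d}. ?F A (d - k))"
    using insert.IH by auto
  have "card (?F (insert a A) d) = (\<Sum>k\<le>d. card (?F A (d - k)))"
    using bij_betw_same_card[OF bij] insert.IH by simp
  also have "\<dots> = (\<Sum>k\<le>d. (card A + (d - k)) choose (d - k))"
    using insert.IH by simp
  \<comment> \<open>Reversing the order of summation prepares for the hockey-stick identity.\<close>
  also have "\<dots> = (\<Sum>k\<le>d. (card A + k) choose k)"
    using sum.nat_diff_reindex[of "\<lambda>k. (card A + k) choose k" "Suc d"]
    by (simp add: lessThan_Suc_atMost)
  also have "\<dots> = (card (insert a A) + d) choose d"
    using insert.hyps by (simp add: sum_choose_lower)
  finally show ?case
    using bij_betw_finite[OF bij] fin by blast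
qed

text \<open>The right-hand side is the product \<open>(d + 1) * ... * (d + n)\<close>, whose
  \<open>n\<close> factors are all at least \<open>d + 1\<close>. Multiplying by
  \<open>fact d\<close> avoids division.\<close>

lemma power_le_fact_times_choose: "(d + 1) ^ n \<le> fact n * ((n + d) choose d)"
proof -
  have "fact d * (d + 1) ^ n \<le> (fact (n + d) :: nat)"
  proof (induction n)
    case (Suc n)
    have "fact d * (d + 1) ^ Suc n = (d + 1) * (fact d * (d + 1) ^ n)"
      by (simp only: power_Suc mult_ac)
    also have "\<dots> \<le> (Suc (n + d)) * fact (n + d)"
      using Suc.IH by (intro mult_le_mono) auto
    finally show ?case
      by simp
  qed simp
  also have "\<dots> = fact d * (fact n * ((n + d) choose d))"
    using binomial_fact_lemma[of d "n + d"] by (simp add: mult.assoc)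
  finally show ?thesis
    by simp
qed

section \<open>Averaging over translates and counting interpolants\<close>

text \<open>Each \<open>b\<close> is moved into \<open>X\<close> by exactly \<open>card X\<close>
  translations, so the intersection sizes sum to \<open>card X * card B\<close> over all
  \<open>g\<close>; some \<open>g\<close> reaches the average.\<close>

lemma exists_translate_large_intersection:
  fixes X :: "'b::{ab_group_add,finite} set"
  shows "\<exists>g. card X * card B \<le> CARD('b) * card {b\<in>B. g + b \<in> X}"
proof (rule ccontr)
  assume "\<not> ?thesis"
  then have less: "CARD('b) * card {b\<in>B. g + b \<in> X} < card X * card B" for g
    by (simp add: not_le)
  have "card {g. g + b \<in> X} = card X" for b
    by (rule bij_betw_same_card[of "\<lambda>g. g + b"], rule bij_betw_byWitness[where f' = "\<lambda>x. x - b"]) auto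
  then have "(\<Sum>g\<in>UNIV. card {b\<in>B. g + b \<in> X}) = card X * card B"
    using sum_multicount_gen[of UNIV B "\<lambda>g b. g + b \<in> X" "\<lambda>_. card X"] by (simp add: mult.commute)
  then have "CARD('b) * (card X * card B) = (\<Sum>g\<in>UNIV. CARD('b) * card {b\<in>B. g + b \<in> X})"
    by (simp only: sum_distrib_left[symmetric])
  also have "\<dots> < (\<Sum>g::'b\<in>UNIV. card X * card B)"
    using less by (intro sum_strict_mono) auto
  finally show False
    by simp
qed

text \<open>A dimension comparison done by counting: choose an interpolant for each function on
  \<open>S\<close> and restrict it to \<open>Y\<close>. If two restrictions agree, the difference of
  the interpolants vanishes on \<open>Y\<close>, hence on \<open>S\<close>, so the two functions on
  \<open>S\<close> coincide.\<close>

lemma card_le_of_interpolation: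
  fixes S Y :: "'b::finite set" and P :: "('b \<Rightarrow> 'a::{field,finite}) \<Rightarrow> bool"
  assumes interp: "\<And>\<phi>. \<exists>f. P f \<and> (\<forall>x\<in>S. f x = \<phi> x)"
    and diff: "\<And>f g. P f \<Longrightarrow> P g \<Longrightarrow> P (\<lambda>x. f x - g x)"
    and zero: "\<And>f x. P f \<Longrightarrow> (\<And>y. y \<in> Y \<Longrightarrow> f y = 0) \<Longrightarrow> x \<in> S \<Longrightarrow> f x = 0"
  shows "card S \<le> card Y"
proof -
  obtain F where F: "\<And>\<phi>. P (F \<phi>)" "\<And>\<phi> x. x \<in> S \<Longrightarrow> F \<phi> x = \<phi> x"
    using interp by metis
  have "inj_on (\<lambda>\<phi>. restrict (F \<phi>) Y) (S \<rightarrow>\<^sub>E UNIV)"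
  proof (rule inj_onI)
    fix \<phi> \<psi> assume *: "\<phi> \<in> S \<rightarrow>\<^sub>E UNIV" "\<psi> \<in> S \<rightarrow>\<^sub>E UNIV"
      and eq: "restrict (F \<phi>) Y = restrict (F \<psi>) Y"
    have "F \<phi> y - F \<psi> y = 0" if "y \<in> Y" for y
      using fun_cong[OF eq, of y] that by simp
    then have "F \<phi> x - F \<psi> x = 0" if "x \<in> S" for x
      using zero[OF diff[OF F(1) F(1)]] that by blast
    then show "\<phi> = \<psi>"
      using * F(2) by (intro PiE_ext[of _ S]) auto
  qed
  then have "card (S \<rightarrow>\<^sub>E (UNIV :: 'a set)) \<le> card (Y \<rightarrow>\<^sub>E (UNIV :: 'a set))"
    by (rule card_inj_on_le) (auto intro: finite_PiE)
  then have "CARD('a) ^ card S \<le> CARD('a) ^ card Y"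
    by (simp add: card_PiE)
  moreover have "1 < CARD('a)"
    using card_mono[of "UNIV :: 'a set" "{0, 1}"] by simp
  ultimately show ?thesis
    by simp
qed

lemma card_mult_choose_le:
  fixes X Y :: "('a::{field,finite} ^ 'n) set"
  assumes d: "d < CARD('a)"
    and zero: "\<And>f x. poly_on_lines d f \<Longrightarrow> (\<And>y. y \<in> Y \<Longrightarrow> f y = 0) \<Longrightarrow> x \<in> X \<Longrightarrow> f x = 0"
  shows "card X * ((CARD('n) + d) choose d) \<le> CARD('a) ^ CARD('n) * card Y"
proof -
  obtain e :: "nat \<Rightarrow> 'a" where "bij_betw e {0..<CARD('a)} UNIV"
    using ex_bij_betw_nat_finite[of "UNIV :: 'a set"] by auto
  \<comment> \<open>The grid needs \<open>d + 1\<close> distinct nodes in the field, which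
    \<open>d < CARD('a)\<close> provides.\<close>
  then have e: "inj_on e {..d}"
    using d by (auto simp: bij_betw_def intro: inj_on_subset)
  define M where "M = {m :: 'n \<Rightarrow> nat. sum m UNIV \<le> d}"
  define pt where "pt m = (\<chi> j. e (m j))" for m :: "'n \<Rightarrow> nat"
  have M: "finite M" "card M = (CARD('n) + d) choose d"
    using card_functions_sum_le[of "UNIV :: 'n set" d] by (simp_all add: M_def)
  have inj: "inj_on pt M"
  proof (rule inj_onI)
    fix m m' assume *: "m \<in> M" "m' \<in> M" "pt m = pt m'"
    show "m = m'"
    proof
      fix j
      have "e (m j) = e (m' j)"
        using *(3) by (simp add: pt_def vec_eq_iff)
      moreover have "m j \<le> d" "m' j \<le> d"
        using * member_le_sum[of j UNIV m] member_le_sum[of j UNIV m'] by (auto simp: M_def)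
      ultimately show "m j = m' j"
        using e by (auto dest: inj_onD)
    qed
  qed
  obtain g where g: "card X * card (pt ` M) \<le> CARD('a ^ 'n) * card {b\<in>pt ` M. g + b \<in> X}"
    using exists_translate_large_intersection by blast
  \<comment> \<open>The points of the translated grid that lie in \<open>X\<close>: being in the
    grid gives interpolation on \<open>S\<close>, being in \<open>X\<close> gives vanishing on
    \<open>S\<close>.\<close>
  define S where "S = (+) g ` {b\<in>pt ` M. g + b \<in> X}"
  have "card S \<le> card Y"
  proof (rule card_le_of_interpolation)
    fix \<phi> :: "'a ^ 'n \<Rightarrow> 'a"
    obtain f where "poly_on_lines d f" "\<forall>m\<in>M. f (g + pt m) = \<phi> (g + pt m)"
      using grid_interpolation[OF e M(1), of g "\<lambda>m. \<phi> (g + pt m)"] by (auto simp: M_def pt_def)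
    then show "\<exists>f. poly_on_lines d f \<and> (\<forall>x\<in>S. f x = \<phi> x)"
      by (auto simp: S_def)
  next
    show "f x = 0" if "poly_on_lines d f" "\<And>y. y \<in> Y \<Longrightarrow> f y = 0" "x \<in> S" for f x
      using zero[OF that(1,2)] that(3) by (auto simp: S_def)
  qed (rule poly_on_lines_diff)
  moreover have "card S = card {b\<in>pt ` M. g + b \<in> X}"
    unfolding S_def by (rule card_image) simp
  ultimately have "card X * card (pt ` M) \<le> CARD('a ^ 'n) * card Y"
    using g by (metis le_trans mult_le_mono2)
  then show ?thesis
    by (simp add: card_image[OF inj] M(2))
qed

theorem corollary5p7:
  fixes L \<gamma> :: "nat \<Rightarrow> ('a::{field,finite} ^ 'n) set"
    and X Y :: "('a ^ 'n) set"
    and q n c :: nat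
  assumes "CARD('a) = q"
    and "CARD('n) = n"
    and "\<And>i. i \<in> {1..c} \<Longrightarrow> affine_line (L i)"
    and "X = (\<Union>i\<in>{1..c}. L i)"
    and "\<And>i. i \<in> {1..c} \<Longrightarrow> \<gamma> i \<subseteq> L i"
    and "\<And>i. i \<in> {1..c} \<Longrightarrow> real (card (\<gamma> i)) \<ge> real q / 2"
    and "Y = (\<Union>i\<in>{1..c}. \<gamma> i)"
  shows "real (card Y) \<ge> 1 / (fact n * 2 ^ n) * real (card X)"
proof -
  \<comment> \<open>The largest \<open>d\<close> with \<open>2 * d < q\<close>: every
    \<open>\<gamma> i\<close> has more than \<open>d\<close> points, while
    \<open>q \<le> 2 * (d + 1)\<close> limits the loss to a factor \<open>2 ^ n\<close>.\<close>
  define d where "d = (q - 1) div 2"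
  have "0 < q"
    using assms(1) by auto
  then have d: "d < q" "2 * d < q" "q \<le> 2 * (d + 1)"
    by (auto simp: d_def)
  have "f x = 0" if f: "poly_on_lines d f" "\<And>y. y \<in> Y \<Longrightarrow> f y = 0" and x: "x \<in> X" for f x
  proof -
    obtain i where i: "i \<in> {1..c}" "x \<in> L i"
      using x assms(4) by blast
    have "d < card (\<gamma> i)"
      using assms(6)[OF i(1)] d(2) by linarith
    then show ?thesis
      using poly_on_lines_eq_zero_line[OF f(1) assms(3)[OF i(1)] assms(5)[OF i(1)]] i f(2) assms(7)
      by blast
  qed
  then have le: "card X * ((n + d) choose d) \<le> q ^ n * card Y"
    using card_mult_choose_le[of d Y X] d(1) assms(1,2) by blast
  \<comment> \<open>Bounding \<open>q ^ n\<close> by the binomial coefficient lets \<open>le\<close>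
    apply, after which \<open>q ^ n\<close> cancels.\<close>
  have "q ^ n * card X \<le> (2 * (d + 1)) ^ n * card X"
    using d(3) by (intro mult_le_mono1 power_mono) auto
  also have "\<dots> = 2 ^ n * card X * (d + 1) ^ n"
    by (simp only: power_mult_distrib mult_ac)
  also have "\<dots> \<le> 2 ^ n * card X * (fact n * ((n + d) choose d))"
    by (intro mult_le_mono2 power_le_fact_times_choose)
  also have "\<dots> = fact n * 2 ^ n * (card X * ((n + d) choose d))"
    by (simp only: mult_ac)
  also have "\<dots> \<le> fact n * 2 ^ n * (q ^ n * card Y)"
    by (intro mult_le_mono2 le)
  finally have "q ^ n * card X \<le> q ^ n * (fact n * 2 ^ n * card Y)"
    by (simp only: mult_ac)
  then have "card X \<le> fact n * 2 ^ n * card Y"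
    using \<open>0 < q\<close> by simp
  then have "real (card X) \<le> fact n * 2 ^ n * real (card Y)"
    using of_nat_mono[of "card X" "fact n * 2 ^ n * card Y", where 'a = real] by simp
  then show ?thesis
    by (simp add: field_simps)
qed

end
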